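(* For complex $\alpha,\beta,m,x,z$, $$\sum_{n=0}^{\infty}\frac{\Gamma(-m-n+\alpha+1)\,\bigl(x(x+1)(xz+1)^{-\beta}\bigr)^n}{\Gamma(n+1)\,\Gamma(m-2(m+n)+\alpha+1)}\;{}_2F_1\bigl(-n,1-(m+n)\beta;\,m-2(m+n)+\alpha+1;\,z\bigr)=-\frac{x^m(x+1)^{\alpha+1}\bigl(x(x+1)(xz+1)^{-\beta}\bigr)^{-m}}{\beta x(x+1)z-(2x+1)(xz+1)}.$$
   Context: $\Gamma$ is the Euler gamma function and ${}_2F_1(a,b;c;z)=\sum_{k\ge0}\frac{(a)_k(b)_k}{(c)_k\,k!}z^k$ is the Gauss hypergeometric function, with $(a)_k=a(a+1)\cdots(a+k-1)$.
   Formalization: Proved for α−m not an integer and nonzero x in the component at 0 of the interior of the set where the series converges and x+1, xz+1 avoid (−∞,0]; x^m and (x(x+1)(xz+1)^{-β})^{-m} use matching logarithms (principal ones if compatible or m is an integer). *)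

theory Defs
  imports "HOL-Complex_Analysis.Complex_Analysis"
begin

definition hyp2F1 :: "complex \<Rightarrow> complex \<Rightarrow> complex \<Rightarrow> complex \<Rightarrow> complex" where
  "hyp2F1 a b c z =
     (\<Sum>k. pochhammer a k * pochhammer b k / (pochhammer c k * fact k) * z ^ k)"

definition base :: "complex \<Rightarrow> complex \<Rightarrow> complex \<Rightarrow> complex" where
  "base \<beta> z x = x * (x + 1) * (x * z + 1) powr (- \<beta>)"

definition summand ::
  "complex \<Rightarrow> complex \<Rightarrow> complex \<Rightarrow> complex \<Rightarrow> complex \<Rightarrow> nat \<Rightarrow> complex" where
  "summand \<alpha> \<beta> m z x n =
     Gamma (- m - of_nat n + \<alpha> + 1) * base \<beta> z x ^ n /
     (Gamma (of_nat n + 1) * Gamma (m - 2 * (m + of_nat n) + \<alpha> + 1)) *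
     hyp2F1 (- of_nat n) (1 - (m + of_nat n) * \<beta>) (m - 2 * (m + of_nat n) + \<alpha> + 1) z"

text \<open>
  The series depends on \<open>x\<close> only through \<open>base \<beta> z x\<close>, which is not injective in \<open>x\<close>, so its
  convergence at \<open>x\<close> does not imply the closed form: for \<open>\<beta> = 0\<close> the series is invariant under
  \<open>x \<mapsto> - 1 - x\<close> and the closed form is not. The closed form belongs to the sheet through \<open>x = 0\<close>.
  Hence \<open>x\<close> ranges over the points that can be joined to \<open>0\<close> inside the open set where the series
  converges and the principal powers of \<open>x + 1\<close> and \<open>x z + 1\<close> are holomorphic.
\<close>

definition domain_at_0 :: "complex \<Rightarrow> complex \<Rightarrow> complex \<Rightarrow> complex \<Rightarrow> complex set" where
  "domain_at_0 \<alpha> \<beta> m z =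
     connected_component_set
       (interior {x. x + 1 \<notin> \<real>\<^sub>\<le>\<^sub>0 \<and> x * z + 1 \<notin> \<real>\<^sub>\<le>\<^sub>0 \<and> summable (summand \<alpha> \<beta> m z x)}) 0"

end

theory Submission
  imports Defs
begin

text \<open>
  With \<open>a = \<alpha> - m\<close>, the \<open>n\<close>-th summand is \<open>T n * base \<beta> z x ^ n\<close>, where the finite hypergeometric
  sum makes \<open>T n\<close> the coefficient of \<open>x ^ n\<close> in
  \<open>(1 + x) powr (a - n) * (1 + x z) powr ((m + n) \<beta> - 1)\<close>, that is, in \<open>F * \<phi> ^ n\<close> for
  \<open>\<phi> = x / base \<beta> z x\<close>. Lagrange inversion therefore sums the series near \<open>x = 0\<close>.
  On the domain, \<open>base \<beta> z\<close> is an open map, so its values lie strictly inside the disc of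
  convergence and the sum is holomorphic in \<open>x\<close>. The identity theorem then applies to the closed
  form multiplied by its denominator; since the numerator has no zeros, neither has the
  denominator.
\<close>

section \<open>Formal Lagrange inversion\<close>

text \<open>With \<open>W = fps_X * V\<close> this is the residue identity for the substitution u =
  W: F(W) W' / W^(n+1) and F(u) / u^(n+1) have the same residue. In the induction the constant term
  of F contributes the residue of W' / W^(n+2), which vanishes, and the rest of F drops to index
  n.\<close>

lemma fps_lagrange_inversion:
  fixes F P V :: "'a :: field_char_0 fps"
  assumes "P * V = 1"
  shows "fps_nth ((F oo (fps_X * V)) * fps_deriv (fps_X * V) * P ^ Suc n) n = fps_nth F n"
proof (induction n arbitrary: F)
  case 0
  have "fps_nth P 0 * fps_nth V 0 = 1"
    using arg_cong[OF assms, of "\<lambda>f. fps_nth f 0"] by simp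
  then show ?case
    by (simp add: fps_mult_nth_0 mult.commute)
next
  case (Suc n)
  define W where "W = fps_X * V"
  \<comment> \<open>\<open>F'\<close> is the shifted series (F - F(0)) / X, not the derivative of
    \<open>F\<close>.\<close>
  define F' where "F' = fps_shift 1 F"
  have F: "F = fps_const (fps_nth F 0) + fps_X * F'"
    unfolding F'_def by (rule fps_ext) (auto simp: fps_X_mult_nth)
  have W0: "fps_nth W 0 = 0" by (simp add: W_def)
  have comp: "F oo W = fps_const (fps_nth F 0) + W * (F' oo W)"
    by (subst F) (simp add: fps_compose_add_distrib fps_compose_mult_distrib[OF W0] W0)
  have dPV: "fps_deriv P * V + P * fps_deriv V = 0"
    using arg_cong[OF assms, of fps_deriv] by (simp add: mult_ac add_ac)
  have "fps_deriv W * P ^ Suc (Suc n) = (P * V) * P ^ Suc n + fps_X * (P * fps_deriv V) * P ^ Suc n"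
    by (simp add: W_def algebra_simps)
  also have "P * fps_deriv V = - (fps_deriv P * V)"
    using dPV by (simp add: eq_neg_iff_add_eq_0 add_ac)
  also have "(P * V) * P ^ Suc n + fps_X * - (fps_deriv P * V) * P ^ Suc n
      = (P * V) * P ^ Suc n - fps_X * fps_deriv P * P ^ n * (P * V)"
    by (simp add: algebra_simps)
  finally have dW: "fps_deriv W * P ^ Suc (Suc n) = P ^ Suc n - fps_X * fps_deriv P * P ^ n"
    by (simp add: assms)
  \<comment> \<open>The operator X d/dX multiplies the coefficient at n + 1 by n + 1, so the two
    terms on the right cancel there. Characteristic 0 then allows division by n + 1.\<close>
  have "of_nat (Suc n) * (P ^ Suc n - fps_X * fps_deriv P * P ^ n)
      = of_nat (Suc n) * P ^ Suc n - fps_X * fps_deriv (P ^ Suc n)"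
    by (simp add: fps_deriv_power' algebra_simps del: power_Suc of_nat_Suc)
  then have "fps_nth (of_nat (Suc n) * (P ^ Suc n - fps_X * fps_deriv P * P ^ n)) (Suc n) = 0"
    by (simp add: fps_mult_of_nat_nth del: power_Suc of_nat_Suc)
  then have "fps_nth (P ^ Suc n - fps_X * fps_deriv P * P ^ n) (Suc n) = 0"
    by (simp only: fps_mult_of_nat_nth mult_eq_0_iff of_nat_eq_0_iff) auto
  then have zero: "fps_nth (fps_deriv W * P ^ Suc (Suc n)) (Suc n) = 0"
    by (simp only: dW)
  \<comment> \<open>The factor \<open>W = fps_X * V\<close> in front of \<open>F' oo W\<close>
    cancels one \<open>P\<close> through \<open>P * V = 1\<close>, and its \<open>fps_X\<close>
    lowers the index by one, as the induction hypothesis requires.\<close>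
  have "(F oo W) * fps_deriv W * P ^ Suc (Suc n)
      = fps_const (fps_nth F 0) * (fps_deriv W * P ^ Suc (Suc n))
        + fps_X * ((F' oo W) * fps_deriv W * P ^ Suc n) * (P * V)"
    unfolding comp by (simp add: W_def algebra_simps)
  also have "\<dots> = fps_const (fps_nth F 0) * (fps_deriv W * P ^ Suc (Suc n))
        + fps_X * ((F' oo W) * fps_deriv W * P ^ Suc n)"
    by (simp only: assms mult_1_right)
  finally have "fps_nth ((F oo W) * fps_deriv W * P ^ Suc (Suc n)) (Suc n)
      = fps_nth ((F' oo W) * fps_deriv W * P ^ Suc n) n"
    using zero by (simp del: power_Suc)
  also have "\<dots> = fps_nth F (Suc n)"
    using Suc.IH[of F'] by (simp add: W_def F'_def)
  finally show ?case
    by (simp add: W_def)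
qed

section \<open>The hypergeometric sum as a binomial convolution\<close>

text \<open>The parameter -n truncates the series at k = n. With c = a - 2n + 1 the Gamma quotient
  is \<open>pochhammer c n\<close>, whose first k factors cancel the denominator of the k-th term.
  Since a is not an integer, neither is c, so no Gamma pole or vanishing
  \<open>pochhammer c k\<close> occurs.\<close>

lemma gbinomial_convolution_eq_hyp2F1:
  fixes a b z :: complex
  assumes "a \<notin> \<int>"
  shows "Gamma (a - of_nat n + 1) / (fact n * Gamma (a - 2 * of_nat n + 1)) *
           hyp2F1 (- of_nat n) (- b) (a - 2 * of_nat n + 1) z
         = (\<Sum>k\<le>n. (a - of_nat n gchoose (n - k)) * (b gchoose k) * z ^ k)"
proof -
  define c where "c = a - 2 * of_nat n + 1"
  have "c \<notin> \<int>"
  proof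
    assume "c \<in> \<int>"
    then have "c + 2 * of_nat n - 1 \<in> \<int>" by (intro Ints_diff Ints_add Ints_mult) auto
    then show False using assms by (simp add: c_def)
  qed
  then have c_nonpos: "c \<notin> \<int>\<^sub>\<le>\<^sub>0"
    by (meson nonpos_Ints_Int)
  then have pc: "pochhammer c k \<noteq> 0" for k
    using c_nonpos by (auto simp: pochhammer_eq_0_iff)
  have G: "Gamma (a - of_nat n + 1) / Gamma c = pochhammer c n"
    using pochhammer_Gamma[OF c_nonpos, of n] by (simp add: c_def algebra_simps)
  have coeff: "pochhammer c n / fact n *
      (pochhammer (- of_nat n) k * pochhammer (- b) k / (pochhammer c k * fact k) * z ^ k)
      = (a - of_nat n gchoose (n - k)) * (b gchoose k) * z ^ k" if "k \<le> n" for k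
  proof -
    have "(of_nat n gchoose k :: complex) = fact n / (fact k * fact (n - k))"
      using that by (simp add: binomial_fact flip: binomial_gbinomial)
    then have "(-1) ^ k * pochhammer (- of_nat n) k = (fact n / fact (n - k) :: complex)"
      by (simp add: gbinomial_pochhammer field_simps)
    then have "(-1) ^ k * ((-1) ^ k * pochhammer (- of_nat n) k) = (-1) ^ k * (fact n / fact (n - k) :: complex)"
      by simp
    then have 1: "pochhammer (- of_nat n) k = (-1) ^ k * (fact n / fact (n - k) :: complex)"
      by (simp flip: mult.assoc power_mult_distrib)
    have 2: "b gchoose k = (-1) ^ k * pochhammer (- b) k / fact k"
      by (rule gbinomial_pochhammer)
    \<comment> \<open>The n - k factors of the falling product that starts at a - n end at c + k,
      exactly the tail of \<open>pochhammer c n\<close> beyond its first k factors.\<close>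
    have "a - of_nat n - of_nat (n - k) + 1 = c + of_nat k"
      using that by (simp add: c_def of_nat_diff)
    then have 3: "a - of_nat n gchoose (n - k) = pochhammer (c + of_nat k) (n - k) / fact (n - k)"
      by (simp only: gbinomial_pochhammer'[of "a - of_nat n" "n - k"])
    have 4: "pochhammer c n = pochhammer c k * pochhammer (c + of_nat k) (n - k)"
      using that by (rule pochhammer_product)
    show ?thesis
      unfolding 1 2 3 4 using pc[of k] by (simp add: field_simps)
  qed
  have "hyp2F1 (- of_nat n) (- b) c z = (\<Sum>k\<le>n. pochhammer (- of_nat n) k * pochhammer (- b) k / (pochhammer c k * fact k) * z ^ k)"
    unfolding hyp2F1_def
    by (rule suminf_finite) (auto simp: pochhammer_of_nat_eq_0_iff not_le)
  then have "pochhammer c n / fact n * hyp2F1 (- of_nat n) (- b) c z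
     = (\<Sum>k\<le>n. (a - of_nat n gchoose (n - k)) * (b gchoose k) * z ^ k)"
    by (simp only: sum_distrib_left) (rule sum.cong[OF refl coeff], simp)
  then show ?thesis
    unfolding c_def[symmetric] by (simp add: mult.commute flip: G)
qed

text \<open>Separates the variables: x enters only through the power of
  \<open>base \<beta> z x\<close>, so the series is a power series in that quantity.\<close>

lemma summand_eq:
  assumes "\<alpha> - m \<notin> \<int>"
  shows "summand \<alpha> \<beta> m z x n =
    (\<Sum>k\<le>n. (\<alpha> - m - of_nat n gchoose (n - k)) * ((m + of_nat n) * \<beta> - 1 gchoose k) * z ^ k)
      * base \<beta> z x ^ n"
proof -
  have 1: "- m - of_nat n + \<alpha> + 1 = \<alpha> - m - of_nat n + 1"
    and 2: "m - 2 * (m + of_nat n) + \<alpha> + 1 = \<alpha> - m - 2 * of_nat n + 1"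
    and 3: "1 - (m + of_nat n) * \<beta> = - ((m + of_nat n) * \<beta> - 1)"
    and 4: "Gamma (of_nat n + 1 :: complex) = fact n"
    using Gamma_fact[of n, where 'a = complex] by (simp_all add: algebra_simps)
  show ?thesis
    unfolding summand_def 1 2 3 4 gbinomial_convolution_eq_hyp2F1[OF assms, symmetric]
    by simp
qed

section \<open>Analytic Lagrange inversion\<close>

text \<open>As \<open>w\<close> has derivative 1 / \<open>\<phi> 0\<close> at 0, it has a local
  inverse \<open>g\<close>, and \<open>H\<close> is a holomorphic function of u = w x. The formal
  identity computes the Taylor coefficients in u.\<close>

lemma lagrange_inversion_sums:
  fixes \<phi> H w :: "complex \<Rightarrow> complex"
  assumes \<phi>: "\<phi> analytic_on {0}" "\<phi> 0 \<noteq> 0" and H: "H analytic_on {0}"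
    and w: "\<And>x. w x = x / \<phi> x"
    and C: "\<And>n. (\<lambda>x. H x * deriv w x * \<phi> x ^ Suc n) has_fps_expansion C n"
  shows "eventually (\<lambda>x. (\<lambda>n. fps_nth (C n) n * w x ^ n) sums H x) (nhds 0)"
proof -
  obtain P where P: "\<phi> has_fps_expansion P"
    using analytic_at_imp_has_fps_expansion_0[OF \<phi>(1)] by blast
  have P0: "fps_nth P 0 \<noteq> 0"
    using has_fps_expansion_imp_0_eq_fps_nth_0[OF P] \<phi>(2) by simp
  define W where "W = fps_X * inverse P"
  have w': "w = (\<lambda>x. x * inverse (\<phi> x))"
    by (simp add: fun_eq_iff w divide_inverse)
  have W: "w has_fps_expansion W"
    unfolding w' W_def by (intro fps_expansion_intros P P0)
  have "deriv w 0 = inverse (fps_nth P 0)"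
    using fps_nth_fps_expansion[OF W, of 1] by (simp add: W_def)
  then have "deriv w 0 \<noteq> 0"
    using P0 by simp
  have "w analytic_on {0}"
    using W by (rule has_fps_expansion_imp_analytic_0)
  with H obtain S where S: "open S" "0 \<in> S" "w holomorphic_on S" "H holomorphic_on S"
    by (meson analytic_at_two)
  obtain r where r: "r > 0" "ball 0 r \<subseteq> S" "open (w ` ball 0 r)" "inj_on w (ball 0 r)"
    using has_complex_derivative_locally_invertible[OF S(3,2,1) \<open>deriv w 0 \<noteq> 0\<close>] by blast
  have wB: "w holomorphic_on ball 0 r" and HB: "H holomorphic_on ball 0 r"
    using S r by (auto intro: holomorphic_on_subset)
  obtain g where g: "g holomorphic_on (w ` ball 0 r)" "\<And>x. x \<in> ball 0 r \<Longrightarrow> g (w x) = x"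
    using holomorphic_has_inverse[OF wB open_ball r(4)] by metis
  \<comment> \<open>\<open>G\<close> is \<open>H\<close> in the coordinate u = w x; its Taylor
    series at 0 is the series sought.\<close>
  define G where "G = H \<circ> g"
  have "G holomorphic_on (w ` ball 0 r)"
    unfolding G_def by (rule holomorphic_on_compose_gen[OF g(1) HB]) (use g(2) in auto)
  moreover have w0: "w 0 = 0"
    by (simp add: w)
  then have "0 \<in> w ` ball 0 r"
    using r(1) by (auto intro!: image_eqI[of _ _ 0])
  ultimately have GF: "G has_fps_expansion fps_expansion G 0"
    using has_fps_expansion_fps_expansion r(3) by blast
  define F where "F = fps_expansion G 0"
  have ball: "eventually (\<lambda>x. x \<in> ball 0 r) (nhds (0::complex))"
    using r(1) by (intro eventually_nhds_in_open) auto
  then have HG: "eventually (\<lambda>x. (G \<circ> w) x = H x) (nhds 0)"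
    by eventually_elim (simp add: G_def g(2))
  have "(G \<circ> w) has_fps_expansion (F oo W)"
    unfolding F_def by (intro has_fps_expansion_compose GF W) (simp add: W_def)
  then have HF: "H has_fps_expansion (F oo W)"
    using has_fps_expansion_cong[OF HG refl] by blast
  have PW: "P * inverse P = 1"
    using P0 by (rule inverse_mult_eq_1')
  have "(\<lambda>x. H x * deriv w x * \<phi> x ^ Suc n) has_fps_expansion (F oo W) * fps_deriv W * P ^ Suc n" for n
    by (intro fps_expansion_intros HF W P)
  \<comment> \<open>Uniqueness of expansions identifies any supplied \<open>C n\<close> with the
    formal product.\<close>
  then have "C n = (F oo W) * fps_deriv W * P ^ Suc n" for n
    using C fps_expansion_unique_complex by blast
  then have CF: "fps_nth (C n) n = fps_nth F n" for n
    using fps_lagrange_inversion[OF PW, of F n] by (simp add: W_def)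
  have "isCont w 0"
    using has_fps_expansion_imp_continuous[OF W] by blast
  then have lim: "filterlim w (nhds 0) (nhds 0)"
    using w0 by (metis isCont_def tendsto_at_iff_tendsto_nhds)
  have "eventually (\<lambda>u. u \<in> eball 0 (fps_conv_radius F)) (nhds 0)"
    using GF by (intro eventually_nhds_in_open) (auto simp: has_fps_expansion_def F_def zero_ereal_def)
  moreover have "eventually (\<lambda>u. eval_fps F u = G u) (nhds 0)"
    using GF by (simp add: has_fps_expansion_def F_def)
  ultimately have "eventually (\<lambda>u. (\<lambda>n. fps_nth F n * u ^ n) sums G u) (nhds 0)"
  proof eventually_elim
    case (elim u)
    then show ?case
      using sums_eval_fps[of u F] by simp
  qed
  then have "eventually (\<lambda>x. (\<lambda>n. fps_nth F n * w x ^ n) sums G (w x)) (nhds 0)"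
    using lim by (auto simp: filterlim_iff)
  with HG show ?thesis
    by eventually_elim (simp add: CF)
qed

section \<open>Power series in a holomorphic function\<close>

text \<open>Convergence at \<open>f x\<close> alone puts \<open>f x\<close> only in the closed disc
  of convergence. By the open mapping theorem \<open>f\<close> also attains a value of larger
  modulus, so \<open>f x\<close> lies strictly inside.\<close>

lemma holomorphic_on_powser_compose:
  fixes f :: "complex \<Rightarrow> complex"
  assumes f: "f holomorphic_on U" and U: "open U" "connected U" and nc: "\<not> f constant_on U"
    and c: "\<And>x. x \<in> U \<Longrightarrow> summable (\<lambda>n. c n * f x ^ n)"
  shows "(\<lambda>x. \<Sum>n. c n * f x ^ n) holomorphic_on U"
proof -
  have "open (f ` U)"
    using open_mapping_thm[OF f U U(1) subset_refl nc] .
  have inner: "f x \<in> eball 0 (fps_conv_radius (Abs_fps c))" if "x \<in> U" for x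
  proof -
    obtain e where e: "e > 0" "ball (f x) e \<subseteq> f ` U"
      using openE[OF \<open>open (f ` U)\<close>, of "f x"] \<open>x \<in> U\<close> by blast
    \<comment> \<open>Moves \<open>f x\<close> radially outward by half of \<open>e\<close>; at
      \<open>f x = 0\<close>, where there is no radial direction, 1 serves as one.\<close>
    define y where "y = f x + of_real (e / 2) * (if f x = 0 then 1 else sgn (f x))"
    have "y \<in> ball (f x) e"
      using e(1) by (simp add: y_def dist_norm norm_mult norm_sgn)
    with e(2) have "y \<in> f ` U"
      by blast
    then have "summable (\<lambda>n. c n * y ^ n)"
      using c by blast
    then have "ereal (norm y) \<le> fps_conv_radius (Abs_fps c)"
      using conv_radius_geI by (simp add: fps_conv_radius_def)
    moreover have "ereal (norm (f x)) < ereal (norm y)"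
    proof (cases "f x = 0")
      case False
      then have "y = sgn (f x) * of_real (norm (f x) + e / 2)"
        by (simp add: y_def sgn_eq field_simps)
      then have "norm y = \<bar>norm (f x) + e / 2\<bar>"
        using False by (simp only: norm_mult norm_sgn norm_of_real) simp
      then show ?thesis
        using e(1) by simp
    qed (use e(1) in \<open>simp add: y_def\<close>)
    ultimately show ?thesis
      by (simp only: in_eball_iff dist_0_norm)
  qed
  have "(eval_fps (Abs_fps c) \<circ> f) holomorphic_on U"
    using inner by (intro holomorphic_on_compose_gen[OF f holomorphic_on_eval_fps[OF subset_refl]]) auto
  then show ?thesis
    by (simp add: eval_fps_def o_def)
qed

section \<open>The series near the origin\<close>

lemma has_fps_expansion_powr_linear:
  fixes c p :: complex
  shows "(\<lambda>x. (x * c + 1) powr p) has_fps_expansion Abs_fps (\<lambda>k. (p gchoose k) * c ^ k)"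
proof -
  have "(\<lambda>x. x * c) has_fps_expansion fps_X * fps_const c"
    by (intro has_fps_expansion_cmult_right has_fps_expansion_fps_X)
  then have "((\<lambda>x. (1 + x) powr p) \<circ> (\<lambda>x. x * c)) has_fps_expansion (fps_binomial p oo (fps_X * fps_const c))"
    by (intro has_fps_expansion_compose has_fps_expansion_binomial_complex) simp_all
  also have "fps_binomial p oo (fps_X * fps_const c) = Abs_fps (\<lambda>k. (p gchoose k) * c ^ k)"
    unfolding mult.commute[of fps_X "fps_const c"] fps_compose_linear
    by (simp add: fps_eq_iff mult.commute)
  finally show ?thesis
    by (simp add: o_def add.commute)
qed

text \<open>The bracket is minus the denominator of the closed form, which is how that denominator
  arises from Lagrange inversion.\<close>

lemma has_field_derivative_base:
  assumes "x * z + 1 \<notin> \<real>\<^sub>\<le>\<^sub>0"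
  shows "(base \<beta> z has_field_derivative
      ((2 * x + 1) * (x * z + 1) - \<beta> * x * (x + 1) * z) * (x * z + 1) powr (- \<beta> - 1)) (at x)"
proof -
  have "x * z + 1 \<noteq> 0"
    using assms by auto
  then have 1: "(x * z + 1) powr (- \<beta>) = (x * z + 1) * (x * z + 1) powr (- \<beta> - 1)"
    by (simp add: powr_diff)
  have "((\<lambda>x. x * (x + 1) * (x * z + 1) powr (- \<beta>)) has_field_derivative
      (2 * x + 1) * (x * z + 1) powr (- \<beta>) + x * (x + 1) * (- \<beta> * (x * z + 1) powr (- \<beta> - 1) * z)) (at x)"
    by (rule derivative_eq_intros refl assms | simp add: algebra_simps)+
  moreover have "base \<beta> z = (\<lambda>x. x * (x + 1) * (x * z + 1) powr (- \<beta>))"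
    by (simp add: fun_eq_iff base_def)
  ultimately show ?thesis
    unfolding 1 by (simp add: algebra_simps)
qed

lemma powr_power_nat_complex: "((a::complex) powr b) ^ n = a powr (of_nat n * b)"
  if "a \<noteq> 0"
  using that by (simp add: powr_def exp_of_nat_mult[symmetric] mult_ac)

lemma eventually_nhds_0_linear_slit:
  fixes c :: complex
  shows "eventually (\<lambda>x. x * c + 1 \<notin> \<real>\<^sub>\<le>\<^sub>0) (nhds 0)"
proof -
  have "open ((\<lambda>x. x * c + 1) -` (- \<real>\<^sub>\<le>\<^sub>0))"
    by (intro open_vimage) (auto intro!: continuous_intros)
  then show ?thesis
    using eventually_nhds_in_open[of _ 0] by fastforce
qed

text \<open>Lagrange inversion with w = \<open>base \<beta> z\<close>. Dividing by \<open>D\<close>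
  in \<open>H\<close> cancels the bracket in the derivative of w, so that H w' \<phi>^(n+1) is a
  product of two powers whose n-th coefficient is the convolution in
  \<open>summand_eq\<close>.\<close>

lemma summand_sums_near_0:
  assumes "\<alpha> - m \<notin> \<int>"
  shows "eventually (\<lambda>x. summand \<alpha> \<beta> m z x sums
      ((x + 1) powr (\<alpha> - m + 1) * (x * z + 1) powr (m * \<beta>)
        / ((2 * x + 1) * (x * z + 1) - \<beta> * x * (x + 1) * z))) (nhds 0)"
proof -
  define D where "D = (\<lambda>x. (2 * x + 1) * (x * z + 1) - \<beta> * x * (x + 1) * z)"
  define H where "H = (\<lambda>x. (x + 1) powr (\<alpha> - m + 1) * (x * z + 1) powr (m * \<beta>) / D x)"
  define \<phi> where "\<phi> = (\<lambda>x. (x * z + 1) powr \<beta> / (x + 1))"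
  \<comment> \<open>The factor \<open>1 ^ k\<close> lets one expansion of (x c + 1)^p serve both c =
    z and c = 1.\<close>
  define C where "C = (\<lambda>n. Abs_fps (\<lambda>k. ((m + of_nat n) * \<beta> - 1 gchoose k) * z ^ k)
      * Abs_fps (\<lambda>k. (\<alpha> - m - of_nat n gchoose k) * 1 ^ k))"
  have "D 0 \<noteq> 0"
    by (simp add: D_def)
  have "isCont D 0"
    unfolding D_def by (intro continuous_intros)
  then have evD: "eventually (\<lambda>x. D x \<noteq> 0) (nhds 0)"
    using \<open>D 0 \<noteq> 0\<close> by (metis isCont_def tendsto_at_iff_tendsto_nhds tendsto_imp_eventually_ne)
  have evp: "eventually (\<lambda>x::complex. x + 1 \<notin> \<real>\<^sub>\<le>\<^sub>0) (nhds 0)"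
    using eventually_nhds_0_linear_slit[of 1] by simp
  have evq: "eventually (\<lambda>x. x * z + 1 \<notin> \<real>\<^sub>\<le>\<^sub>0) (nhds 0)"
    by (rule eventually_nhds_0_linear_slit)
  have "eventually (\<lambda>x. (\<lambda>n. fps_nth (C n) n * base \<beta> z x ^ n) sums H x) (nhds 0)"
  proof (rule lagrange_inversion_sums[where \<phi> = \<phi>])
    show "\<phi> analytic_on {0}" "\<phi> 0 \<noteq> 0"
      unfolding \<phi>_def by (auto intro!: analytic_intros)
    have "D analytic_on {0}"
      unfolding D_def by (intro analytic_intros)
    then show "H analytic_on {0}"
      unfolding H_def using \<open>D 0 \<noteq> 0\<close> by (auto intro!: analytic_intros)
    \<comment> \<open>This holds even where x + 1 or x z + 1 vanishes: with x / 0 = 0 and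
      \<open>0 powr p = 0\<close>, both sides are 0 there.\<close>
    show "base \<beta> z x = x / \<phi> x" for x
      by (simp add: base_def \<phi>_def powr_minus divide_inverse mult_ac)
    fix n
    have "(\<lambda>x. (x * z + 1) powr ((m + of_nat n) * \<beta> - 1) * (x * 1 + 1) powr (\<alpha> - m - of_nat n))
        has_fps_expansion C n"
      unfolding C_def by (intro has_fps_expansion_mult has_fps_expansion_powr_linear)
    moreover have "eventually (\<lambda>x. H x * deriv (base \<beta> z) x * \<phi> x ^ Suc n =
        (x * z + 1) powr ((m + of_nat n) * \<beta> - 1) * (x * 1 + 1) powr (\<alpha> - m - of_nat n)) (nhds 0)"
      using evD evp evq
    proof eventually_elim
      case (elim x)
      define p q where "p = x + 1" and "q = x * z + 1"
      have nz: "p \<noteq> 0" "q \<noteq> 0"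
        using elim by (auto simp: p_def q_def)
      have "deriv (base \<beta> z) x = D x * q powr (- \<beta> - 1)"
        using has_field_derivative_base[OF elim(3), of \<beta>] by (simp add: DERIV_imp_deriv D_def q_def)
      then have "H x * deriv (base \<beta> z) x
          = p powr (\<alpha> - m + 1) * (q powr (m * \<beta>) * q powr (- \<beta> - 1))"
        using elim(1) by (simp add: H_def p_def q_def)
      moreover have "\<phi> x ^ Suc n = q powr (of_nat (Suc n) * \<beta>) * p powr (- of_nat (Suc n))"
        using nz by (simp add: \<phi>_def p_def[symmetric] q_def[symmetric] power_divide
            powr_power_nat_complex powr_minus divide_inverse powr_nat' power_mult_distrib power_inverse del: power_Suc of_nat_Suc)
      ultimately have "H x * deriv (base \<beta> z) x * \<phi> x ^ Suc n
          = (p powr (\<alpha> - m + 1) * p powr (- of_nat (Suc n)))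
            * (q powr (m * \<beta>) * q powr (- \<beta> - 1) * q powr (of_nat (Suc n) * \<beta>))"
        by (simp add: mult_ac)
      \<comment> \<open>Adding exponents over one fixed base is free of branch conditions.\<close>
      also have "\<dots> = p powr (\<alpha> - m + 1 + - of_nat (Suc n)) * q powr (m * \<beta> + (- \<beta> - 1) + of_nat (Suc n) * \<beta>)"
        by (simp only: powr_add)
      also have "\<dots> = p powr (\<alpha> - m - of_nat n) * q powr ((m + of_nat n) * \<beta> - 1)"
        by (simp add: algebra_simps)
      finally show ?case
        by (simp add: p_def q_def)
    qed
    ultimately show "(\<lambda>x. H x * deriv (base \<beta> z) x * \<phi> x ^ Suc n) has_fps_expansion C n"
      by (subst has_fps_expansion_cong[OF _ refl])
  qed
  moreover have "summand \<alpha> \<beta> m z x = (\<lambda>n. fps_nth (C n) n * base \<beta> z x ^ n)" for x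
  proof
    fix n
    have "fps_nth (C n) n = (\<Sum>k\<le>n. (\<alpha> - m - of_nat n gchoose (n - k))
        * ((m + of_nat n) * \<beta> - 1 gchoose k) * z ^ k)"
      unfolding C_def fps_mult_nth by (simp add: atLeast0AtMost mult_ac)
    then show "summand \<alpha> \<beta> m z x n = fps_nth (C n) n * base \<beta> z x ^ n"
      by (simp only: summand_eq[OF assms])
  qed
  ultimately show ?thesis
    by (simp add: H_def D_def)
qed

section \<open>Continuation over the domain and choice of branches\<close>

theorem proposition3p20:
  fixes \<alpha> \<beta> m z :: complex
  assumes "\<alpha> - m \<notin> \<int>"
  shows "open (domain_at_0 \<alpha> \<beta> m z) \<and> 0 \<in> domain_at_0 \<alpha> \<beta> m z \<and>
    (\<forall>x \<in> domain_at_0 \<alpha> \<beta> m z - {0}.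
      \<comment> \<open>principal values of all powers, when their branches are compatible\<close>
      ((Ln (base \<beta> z x) = Ln x + Ln (x + 1) - \<beta> * Ln (x * z + 1) \<or> m \<in> \<int>) \<longrightarrow>
        summand \<alpha> \<beta> m z x sums
          (- (x powr m * (x + 1) powr (\<alpha> + 1) * base \<beta> z x powr (- m)
              / (\<beta> * x * (x + 1) * z - (2 * x + 1) * (x * z + 1))))) \<and>
      \<comment> \<open>any logarithm \<open>\<xi>\<close> of \<open>x\<close>, with the matching logarithm \<open>\<omega>\<close> of \<open>base \<beta> z x\<close>\<close>
      (\<forall>\<xi> \<omega>. exp \<xi> = x \<and> \<omega> = \<xi> + Ln (x + 1) - \<beta> * Ln (x * z + 1) \<longrightarrow>
        summand \<alpha> \<beta> m z x sums
          (- (exp (m * \<xi>) * (x + 1) powr (\<alpha> + 1) * exp (- m * \<omega>)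
              / (\<beta> * x * (x + 1) * z - (2 * x + 1) * (x * z + 1))))))"
proof -
  define U where "U = domain_at_0 \<alpha> \<beta> m z"
  define I where "I = interior {x. x + 1 \<notin> \<real>\<^sub>\<le>\<^sub>0 \<and> x * z + 1 \<notin> \<real>\<^sub>\<le>\<^sub>0 \<and> summable (summand \<alpha> \<beta> m z x)}"
  define D where "D = (\<lambda>x. (2 * x + 1) * (x * z + 1) - \<beta> * x * (x + 1) * z)"
  define N where "N = (\<lambda>x. (x + 1) powr (\<alpha> - m + 1) * (x * z + 1) powr (m * \<beta>))"
  define g where "g = (\<lambda>x. \<Sum>n. summand \<alpha> \<beta> m z x n)"
  have UI: "U = connected_component_set I 0"
    by (simp add: U_def I_def domain_at_0_def)
  have U: "open U" "connected U"
    unfolding UI by (simp_all add: I_def open_connected_component)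
  have "U \<subseteq> I"
    unfolding UI by (rule connected_component_subset)
  then have Ux: "x + 1 \<notin> \<real>\<^sub>\<le>\<^sub>0" "x * z + 1 \<notin> \<real>\<^sub>\<le>\<^sub>0" "summable (summand \<alpha> \<beta> m z x)" if "x \<in> U" for x
    using that interior_subset unfolding I_def by blast+
  have near: "eventually (\<lambda>x. summand \<alpha> \<beta> m z x sums (N x / D x)) (nhds 0)"
    using summand_sums_near_0[OF assms, of \<beta> z] by (simp add: N_def D_def)
  have "eventually (\<lambda>x. x + 1 \<notin> \<real>\<^sub>\<le>\<^sub>0 \<and> x * z + 1 \<notin> \<real>\<^sub>\<le>\<^sub>0 \<and> summable (summand \<alpha> \<beta> m z x)) (nhds 0)"
    using near eventually_nhds_0_linear_slit[of 1] eventually_nhds_0_linear_slit[of z]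
    by eventually_elim (auto simp: sums_iff)
  then have "0 \<in> I"
    unfolding I_def eventually_nhds by (auto intro: interiorI)
  then have "0 \<in> U"
    by (simp add: UI)
  have base_holo: "base \<beta> z holomorphic_on U"
    unfolding holomorphic_on_open[OF U(1)] using has_field_derivative_base[OF Ux(2)] by blast
  have base_nz: "base \<beta> z x \<noteq> 0" if "x \<in> U" "x \<noteq> 0" for x
    proof -
    have "x + 1 \<noteq> 0" "x * z + 1 \<noteq> 0"
      using Ux(1,2)[OF that(1)] by auto
    then show ?thesis
      using that(2) by (simp add: base_def)
  qed
  \<comment> \<open>Needed for the open mapping theorem. A constant value would be the value 0 at
    the origin, whereas \<open>base \<beta> z\<close> has no other zero in the open set
    \<open>U\<close>.\<close>
  have "\<not> base \<beta> z constant_on U"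
  proof
    assume "base \<beta> z constant_on U"
    then have "base \<beta> z x = base \<beta> z 0" if "x \<in> U" for x
      using that \<open>0 \<in> U\<close> unfolding constant_on_def by metis
    then have "base \<beta> z x = 0" if "x \<in> U" for x
      using that by (simp add: base_def)
    then have "U = {0}"
      using \<open>0 \<in> U\<close> base_nz by blast
    then show False
      using U(1) not_open_singleton by blast
  qed
  define c where "c = (\<lambda>n. \<Sum>k\<le>n. (\<alpha> - m - of_nat n gchoose (n - k)) * ((m + of_nat n) * \<beta> - 1 gchoose k) * z ^ k)"
  have summand_c: "summand \<alpha> \<beta> m z x = (\<lambda>n. c n * base \<beta> z x ^ n)" for x
    by (simp add: fun_eq_iff c_def summand_eq[OF assms])
  have g_holo: "g holomorphic_on U"
    using holomorphic_on_powser_compose[OF base_holo U \<open>\<not> base \<beta> z constant_on U\<close>, of c] Ux(3)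
    by (simp add: g_def summand_c)
  \<comment> \<open>In this product form both sides are holomorphic on all of \<open>U\<close>
    before anything is known about the zeros of \<open>D\<close>.\<close>
  have gDN: "g x * D x = N x" if "x \<in> U" for x
  proof -
    have "isCont D 0" "D 0 \<noteq> 0"
      by (auto simp: D_def intro!: continuous_intros)
    then have "eventually (\<lambda>x. D x \<noteq> 0) (nhds 0)"
      by (metis isCont_def tendsto_at_iff_tendsto_nhds tendsto_imp_eventually_ne)
    moreover have "eventually (\<lambda>x. x \<in> U) (nhds 0)"
      using U(1) \<open>0 \<in> U\<close> by (rule eventually_nhds_in_open)
    ultimately have "eventually (\<lambda>x. x \<in> U \<and> g x * D x = N x) (nhds 0)"
      using near by eventually_elim (auto simp: g_def sums_iff)
    then obtain S where S: "open S" "0 \<in> S" "\<And>x. x \<in> S \<Longrightarrow> x \<in> U \<and> g x * D x = N x"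
      unfolding eventually_nhds by blast
    have "(\<lambda>x. g x * D x) holomorphic_on U"
      unfolding D_def by (intro holomorphic_intros g_holo)
    moreover have "N holomorphic_on U"
      unfolding N_def using Ux by (auto intro!: holomorphic_intros)
    ultimately show ?thesis
      using analytic_continuation_open[of S U "\<lambda>x. g x * D x" N x] S U that by blast
  qed
  have main: "summand \<alpha> \<beta> m z x sums
      (- (exp (m * \<xi>) * (x + 1) powr (\<alpha> + 1) * exp (- m * \<omega>)
        / (\<beta> * x * (x + 1) * z - (2 * x + 1) * (x * z + 1))))"
    if x: "x \<in> U" and \<omega>: "\<omega> = \<xi> + Ln (x + 1) - \<beta> * Ln (x * z + 1)" for x \<xi> \<omega>
  proof -
    have nz: "x + 1 \<noteq> 0" "x * z + 1 \<noteq> 0"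
      using Ux(1,2)[OF x] by auto
    have "N x \<noteq> 0"
      using nz by (simp add: N_def)
    then have "D x \<noteq> 0"
      using gDN[OF x] by auto
    \<comment> \<open>The terms in \<open>\<xi>\<close> cancel between the two exponentials, so
      every logarithm of x gives the same value.\<close>
    have "exp (m * \<xi>) * (x + 1) powr (\<alpha> + 1) * exp (- m * \<omega>)
        = exp (m * \<xi> + (\<alpha> + 1) * Ln (x + 1) + - m * \<omega>)"
      using nz by (simp only: exp_add powr_def if_False)
    also have "\<dots> = exp ((\<alpha> - m + 1) * Ln (x + 1) + (m * \<beta>) * Ln (x * z + 1))"
      by (simp add: \<omega> algebra_simps)
    also have "\<dots> = N x"
      using nz by (simp only: N_def exp_add powr_def if_False)
    finally have "- (exp (m * \<xi>) * (x + 1) powr (\<alpha> + 1) * exp (- m * \<omega>)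
        / (\<beta> * x * (x + 1) * z - (2 * x + 1) * (x * z + 1))) = N x / D x"
      by (simp add: D_def flip: divide_minus_right)
    also have "\<dots> = g x"
      using gDN[OF x] \<open>D x \<noteq> 0\<close> by (simp add: field_simps)
    finally show ?thesis
      using Ux(3)[OF x] by (simp add: g_def summable_sums)
  qed
  have principal: "summand \<alpha> \<beta> m z x sums
      (- (x powr m * (x + 1) powr (\<alpha> + 1) * base \<beta> z x powr (- m)
        / (\<beta> * x * (x + 1) * z - (2 * x + 1) * (x * z + 1))))"
    if x: "x \<in> U" "x \<noteq> 0"
      and branch: "Ln (base \<beta> z x) = Ln x + Ln (x + 1) - \<beta> * Ln (x * z + 1) \<or> m \<in> \<int>" for x
  proof -
    define \<omega> where "\<omega> = Ln x + Ln (x + 1) - \<beta> * Ln (x * z + 1)"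
    have nz: "x + 1 \<noteq> 0" "x * z + 1 \<noteq> 0"
      using Ux(1,2)[OF x(1)] by auto
    have "exp (- m * Ln (base \<beta> z x)) = exp (- m * \<omega>)"
      using branch
    proof
      \<comment> \<open>\<open>Ln (base \<beta> z x)\<close> and \<open>\<omega>\<close> are
        logarithms of the same number; they may differ by a multiple of 2 pi i, which an integer m
        makes invisible. Integer powers of the two equal exponentials express this.\<close>
      assume "m \<in> \<int>"
      have "exp (Ln (base \<beta> z x)) = exp \<omega>"
        using base_nz[OF x] nz x(2)
        by (simp add: \<omega>_def exp_add exp_diff base_def powr_def exp_minus divide_inverse)
      then have "exp (Ln (base \<beta> z x)) powi k = exp \<omega> powi k" for k
        by simp
      then show ?thesis
        using \<open>m \<in> \<int>\<close> by (auto elim!: Ints_cases simp: exp_power_int mult.commute exp_minus)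
    qed (simp add: \<omega>_def)
    then have "base \<beta> z x powr (- m) = exp (- m * \<omega>)"
      using base_nz[OF x] by (simp add: powr_def)
    moreover have "x powr m = exp (m * Ln x)"
      using x(2) by (simp add: powr_def)
    ultimately show ?thesis
      using main[OF x(1) \<omega>_def] by simp
  qed
  show ?thesis
    unfolding U_def[symmetric] using U(1) \<open>0 \<in> U\<close> main principal by blast
qed

end
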